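(* Let $\delta \in (0,1)$ and consider the Glauber dynamics for the hardcore model with fugacity $\lambda>0$ on a graph $G$ with $n$ vertices. If $$\lambda \le \frac{1-\delta}{-\lambda_{\min}(A_G) - 1},$$ where $\lambda_{\min}(A_G)$ is the minimum eigenvalue of the adjacency matrix $A_G$ of $G$, then the mixing time satisfies $T_{\mathrm{mix}}(P_{\mathrm{GD}}) = O\left(\frac{n^2}{\delta}\log\frac{1}{\lambda}\right)$.
   Context: For a graph $G=(V,E)$, let $\mathcal{I}(G)$ be the set of independent sets of $G$. The hardcore model with fugacity $\lambda>0$ is the distribution $\mu(S) = \lambda^{|S|}/Z$ for $S \in \mathcal{I}(G)$, where $Z = \sum_{S\in\mathcal{I}(G)}\lambda^{|S|}$. The Glauber dynamics $P_{\mathrm{GD}}$: from the current state $S_t$, pick $v\in V$ uniformly at random, let $S' = S_t\setminus\{v\}$; if $S'\cup\{v\}\notin\mathcal{I}(G)$ set $S_{t+1}=S'$; otherwise set $S_{t+1}=S'\cup\{v\}$ with probability $\frac{\lambda}{1+\lambda}$ and $S_{t+1}=S'$ otherwise. Its mixing time is $T_{\mathrm{mix}}(P) = \max_{S}\min\{t : d_{\mathrm{TV}}(P^t(S,\cdot),\mu)\le 1/4\}$, where $d_{\mathrm{TV}}$ is total variation distance.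
   Formalization: The bound is proved with max(1, log(1/λ)) in place of log(1/λ), since the literal bound fails for λ near or above 1 (e.g. the 3-vertex path, λ=1, δ=1/2); the case λ_min(A_G) = -1, where the quotient is undefined, is excluded. *)

theory Defs
  imports "HOL-Probability.Probability" "Jordan_Normal_Form.Spectral_Radius"
begin

text \<open>A finite simple graph with \<open>n\<close> vertices has vertex set \<open>{..<n}\<close> and a set of
  two-element subsets of it as edges; so \<open>u\<close> and \<open>v\<close> are adjacent iff \<open>{u, v} \<in> E\<close>.\<close>

definition simple_graph :: "nat \<Rightarrow> nat set set \<Rightarrow> bool" where
  "simple_graph n E \<longleftrightarrow> E \<subseteq> {e. e \<subseteq> {..<n} \<and> card e = 2}"

definition adjacency_matrix :: "nat \<Rightarrow> nat set set \<Rightarrow> real mat" where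
  "adjacency_matrix n E = mat n n (\<lambda>(u, v). if {u, v} \<in> E then 1 else 0)"

text \<open>Meant for real symmetric matrices of dimension at least 1, whose eigenvalues are all real;
  the minimum of the empty spectrum is unspecified. In the fugacity bound
  \<open>l \<le> (1 - \<delta>) / (- lambda_min A - 1)\<close> a vanishing denominator makes the quotient 0, so the
  bound is then never met by a positive \<open>l\<close> (nor for an edgeless graph, where it is negative).\<close>

definition lambda_min :: "real mat \<Rightarrow> real" where
  "lambda_min A = Min (spectrum A)"

definition indep_sets_of :: "nat \<Rightarrow> nat set set \<Rightarrow> nat set set" where
  "indep_sets_of n E = {S. S \<subseteq> {..<n} \<and> (\<forall>u\<in>S. \<forall>v\<in>S. {u, v} \<notin> E)}"

definition hardcore_Z :: "nat \<Rightarrow> nat set set \<Rightarrow> real \<Rightarrow> real" where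
  "hardcore_Z n E l = (\<Sum>S\<in>indep_sets_of n E. l ^ card S)"

definition hardcore :: "nat \<Rightarrow> nat set set \<Rightarrow> real \<Rightarrow> nat set pmf" where
  "hardcore n E l =
     embed_pmf (\<lambda>S. if S \<in> indep_sets_of n E then l ^ card S / hardcore_Z n E l else 0)"

lemma finite_indep_sets_of: "finite (indep_sets_of n E)"
  by (rule finite_subset[of _ "Pow {..<n}"]) (auto simp: indep_sets_of_def)

lemma empty_in_indep_sets_of: "{} \<in> indep_sets_of n E"
  by (simp add: indep_sets_of_def)

lemma hardcore_Z_pos:
  assumes "0 < l"
  shows "0 < hardcore_Z n E l"
  unfolding hardcore_Z_def
  by (rule sum_pos) (use assms finite_indep_sets_of empty_in_indep_sets_of[of n E] in auto)

text \<open>The argument of \<^const>\<open>embed_pmf\<close> above is indeed a probability mass function.\<close>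

lemma pmf_hardcore:
  assumes "0 < l"
  shows "pmf (hardcore n E l) S =
    (if S \<in> indep_sets_of n E then l ^ card S / hardcore_Z n E l else 0)"
  unfolding hardcore_def
proof (rule pmf_embed_pmf)
  let ?f = "\<lambda>S. if S \<in> indep_sets_of n E then l ^ card S / hardcore_Z n E l else 0"
  show nonneg: "0 \<le> ?f S" for S
    using assms hardcore_Z_pos[OF assms, of n E] by simp
  have "(\<integral>\<^sup>+ S. ennreal (?f S) \<partial>count_space UNIV) =
        (\<integral>\<^sup>+ S. ennreal (?f S) \<partial>count_space (indep_sets_of n E))"
    by (subst (2) nn_integral_count_space_indicator)
       (auto intro!: nn_integral_cong simp: indicator_def)
  also have "\<dots> = (\<Sum>S\<in>indep_sets_of n E. ennreal (?f S))"
    by (rule nn_integral_count_space_finite) (rule finite_indep_sets_of)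
  also have "\<dots> = ennreal (\<Sum>S\<in>indep_sets_of n E. ?f S)"
    by (rule sum_ennreal) (rule nonneg)
  also have "(\<Sum>S\<in>indep_sets_of n E. ?f S) = hardcore_Z n E l / hardcore_Z n E l"
    by (simp add: hardcore_Z_def flip: sum_divide_distrib)
  also have "\<dots> = 1"
    using hardcore_Z_pos[OF assms, of n E] by simp
  finally show "(\<integral>\<^sup>+ S. ennreal (?f S) \<partial>count_space UNIV) = 1" by simp
qed

definition glauber :: "nat \<Rightarrow> nat set set \<Rightarrow> real \<Rightarrow> nat set \<Rightarrow> nat set pmf" where
  "glauber n E l S =
     bind_pmf (pmf_of_set {..<n}) (\<lambda>v.
       let S' = S - {v} in
       if insert v S' \<notin> indep_sets_of n E then return_pmf S'
       else map_pmf (\<lambda>b. if b then insert v S' else S') (bernoulli_pmf (l / (1 + l))))"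

text \<open>\<open>kernel_pow P t x\<close> is the law after \<open>t\<close> steps of the Markov chain with transition
  kernel \<open>P\<close> started at \<open>x\<close>.\<close>

definition kernel_pow :: "('a \<Rightarrow> 'a pmf) \<Rightarrow> nat \<Rightarrow> 'a \<Rightarrow> 'a pmf" where
  "kernel_pow P t x = ((\<lambda>p. bind_pmf p P) ^^ t) (return_pmf x)"

definition tv_dist :: "'a pmf \<Rightarrow> 'a pmf \<Rightarrow> real" where
  "tv_dist p q = (SUP A. \<bar>measure_pmf.prob p A - measure_pmf.prob q A\<bar>)"

text \<open>Meant for finite nonempty \<open>X\<close> and a chain converging to \<open>\<mu>\<close> from every state in \<open>X\<close>;
  otherwise \<^const>\<open>Max\<close> or \<^const>\<open>Least\<close> is unspecified.\<close>

definition mixing_time :: "'a set \<Rightarrow> ('a \<Rightarrow> 'a pmf) \<Rightarrow> 'a pmf \<Rightarrow> nat" where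
  "mixing_time X P \<mu> = Max ((\<lambda>x. LEAST t. tv_dist (kernel_pow P t x) \<mu> \<le> 1 / 4) ` X)"

end

theory Submission
  imports Defs
begin

text \<open>
  Let \<open>D\<^sub>v = I - E\<^sub>v\<close>, where \<open>E\<^sub>v\<close> is the conditional expectation given the configuration off \<open>v\<close>;
  these are projections in \<open>L\<^sup>2(\<mu>)\<close>, and the Glauber kernel is \<open>I - L/n\<close> with \<open>L = \<Sum>\<^sub>v D\<^sub>v\<close>. In the
  expansion of \<open>\<parallel>L f\<parallel>\<^sup>2\<close> nonadjacent vertices contribute nonnegatively, and the remaining terms form
  \<open>I + l/(1+l) A\<close> evaluated at the discrete gradient of \<open>f\<close>. The fugacity bound makes this at
  least \<open>\<delta>/(1+l)\<close>, so the spectral gap of the chain is of order \<open>\<delta>/n\<close>; together with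
  \<open>log (1/\<mu>(S)) = O(n max(1, log (1/l)))\<close> this bounds the mixing time. That \<open>l\<close> is bounded follows
  because \<open>lambda_min < -1\<close> forces \<open>lambda_min \<le> -\<surd>2\<close>.
\<close>

section \<open>The least eigenvalue of the adjacency matrix\<close>

definition quad_form :: "real mat \<Rightarrow> nat \<Rightarrow> (nat \<Rightarrow> real) \<Rightarrow> real" where
  "quad_form A n x = (\<Sum>i<n. \<Sum>j<n. A $$ (i, j) * x i * x j)"

lemma eigenvalueI_fun:
  fixes A :: "real mat"
  assumes A: "A \<in> carrier_mat n n"
    and eq: "\<And>i. i < n \<Longrightarrow> (\<Sum>j<n. A $$ (i, j) * x j) = k * x i"
    and nz: "i < n" "x i \<noteq> 0"
  shows "eigenvalue A k"
proof -
  have "A *\<^sub>v vec n x = k \<cdot>\<^sub>v vec n x"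
  proof (rule eq_vecI)
    fix i assume "i < dim_vec (k \<cdot>\<^sub>v vec n x)"
    then have i: "i < n" by simp
    then show "(A *\<^sub>v vec n x) $ i = (k \<cdot>\<^sub>v vec n x) $ i"
      using A eq[OF i] by (simp add: scalar_prod_def atLeast0LessThan)
  qed (use A in auto)
  moreover have "vec n x \<noteq> 0\<^sub>v n"
    using nz by (metis index_vec index_zero_vec(1))
  ultimately show ?thesis
    using A unfolding eigenvalue_def eigenvector_def by (intro exI[of _ "vec n x"]) auto
qed

lemma eigenvalueE_fun:
  fixes A :: "real mat"
  assumes A: "A \<in> carrier_mat n n" and "eigenvalue A k"
  obtains x i where "\<And>i. i < n \<Longrightarrow> (\<Sum>j<n. A $$ (i, j) * x j) = k * x i" "i < n" "x i \<noteq> 0"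
proof -
  from assms obtain v where v: "v \<in> carrier_vec n" "v \<noteq> 0\<^sub>v n" "A *\<^sub>v v = k \<cdot>\<^sub>v v"
    unfolding eigenvalue_def eigenvector_def by auto
  have "(\<Sum>j<n. A $$ (i, j) * (v $ j)) = k * (v $ i)" if i: "i < n" for i
  proof -
    have "(A *\<^sub>v v) $ i = (k \<cdot>\<^sub>v v) $ i" using v by simp
    then show ?thesis using A i v(1) by (simp add: scalar_prod_def atLeast0LessThan)
  qed
  moreover obtain i where "i < n" "v $ i \<noteq> 0"
    using v by (metis carrier_vecD eq_vecI index_zero_vec)
  ultimately show thesis using that by blast
qed

text \<open>Vectors are functions on \<open>nat\<close> vanishing from \<open>n\<close> on, so the
  unit sphere is a closed subset of a product of compact intervals and Tychonoff applies.\<close>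

lemma compact_sphere_fun: "compact {x :: nat \<Rightarrow> real. (\<forall>i\<ge>n. x i = 0) \<and> (\<Sum>i<n. (x i)\<^sup>2) = 1}"
proof -
  define B where "B = (\<Pi>\<^sub>E i\<in>UNIV::nat set. {-1..1::real})"
  have "compactin (product_topology (\<lambda>_. euclidean) UNIV) B"
    unfolding B_def by (subst compactin_PiE) auto
  then have cB: "compact B" by (simp add: euclidean_product_topology)
  have cl: "closed {x :: nat \<Rightarrow> real. (\<forall>i\<ge>n. x i = 0) \<and> (\<Sum>i<n. (x i)\<^sup>2) = 1}"
    by (intro closed_Collect_conj closed_Collect_all closed_Collect_imp open_Collect_const
          closed_Collect_eq continuous_intros continuous_on_product_coordinates)
  have sub: "{x :: nat \<Rightarrow> real. (\<forall>i\<ge>n. x i = 0) \<and> (\<Sum>i<n. (x i)\<^sup>2) = 1} \<subseteq> B"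
  proof
    fix x :: "nat \<Rightarrow> real" assume x: "x \<in> {x. (\<forall>i\<ge>n. x i = 0) \<and> (\<Sum>i<n. (x i)\<^sup>2) = 1}"
    have "\<bar>x i\<bar> \<le> 1" for i
    proof (cases "i < n")
      case True
      then have "(x i)\<^sup>2 \<le> (\<Sum>i<n. (x i)\<^sup>2)"
        by (intro member_le_sum) auto
      then show ?thesis using x by (simp add: abs_square_le_1)
    qed (use x in auto)
    then show "x \<in> B" by (auto simp: B_def abs_le_iff minus_le_iff)
  qed
  then show ?thesis using compact_Int_closed[OF cB cl] by (simp add: Int_absorb1)
qed

text \<open>The minimum of the quadratic form over the unit sphere is attained, and its first-order
  condition makes the minimiser an eigenvector.\<close>

lemma symmetric_min_eigenvalue:
  fixes A :: "real mat"
  assumes A: "A \<in> carrier_mat n n" and n: "0 < n"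
    and sym: "\<And>i j. i < n \<Longrightarrow> j < n \<Longrightarrow> A $$ (i, j) = A $$ (j, i)"
  obtains k where "eigenvalue A k" "\<And>x. k * (\<Sum>i<n. (x i)\<^sup>2) \<le> quad_form A n x"
proof -
  let ?K = "{x :: nat \<Rightarrow> real. (\<forall>i\<ge>n. x i = 0) \<and> (\<Sum>i<n. (x i)\<^sup>2) = 1}"
  have "(\<Sum>i<n. (if i = 0 then 1 else 0 :: real)\<^sup>2) = (\<Sum>i<n. if i = 0 then 1 else 0)"
    by (intro sum.cong) auto
  also have "\<dots> = 1" using n by simp
  finally have "(\<lambda>i. if i = 0 then 1 else 0) \<in> ?K" using n by simp
  then have ne: "?K \<noteq> {}" by (metis empty_iff)
  have cont: "continuous_on ?K (quad_form A n)"
    unfolding quad_form_def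
    by (intro continuous_intros continuous_on_subset[OF continuous_on_product_coordinates]) auto
  obtain x where x: "x \<in> ?K" and min: "\<And>y. y \<in> ?K \<Longrightarrow> quad_form A n x \<le> quad_form A n y"
    using continuous_attains_inf[OF compact_sphere_fun ne cont] by blast
  define k where "k = quad_form A n x"
  \<comment> \<open>\<open>R\<close> is the quadratic form of \<open>A - k I\<close>. Homogeneity
    carries its nonnegativity from the sphere to all vectors, and it vanishes at
    \<open>x\<close>.\<close>
  define R where "R y = quad_form A n y - k * (\<Sum>i<n. (y i)\<^sup>2)" for y
  have bound: "0 \<le> R y" for y
  proof (cases "(\<Sum>i<n. (y i)\<^sup>2) = 0")
    case True
    then have "\<forall>i<n. y i = 0" by (subst (asm) sum_nonneg_eq_0_iff) auto
    then show ?thesis using True unfolding R_def quad_form_def by (simp add: sum.neutral)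
  next
    case False
    define s where "s = (\<Sum>i<n. (y i)\<^sup>2)"
    have s: "0 < s" using False sum_nonneg[of "{..<n}" "\<lambda>i. (y i)\<^sup>2"] unfolding s_def by simp
    let ?z = "\<lambda>i. if i < n then y i / sqrt s else 0"
    have "(\<Sum>i<n. (?z i)\<^sup>2) = (\<Sum>i<n. (y i)\<^sup>2 / s)"
      using s by (intro sum.cong) (auto simp: power_divide)
    also have "\<dots> = 1" using s by (simp add: s_def flip: sum_divide_distrib)
    finally have "k \<le> quad_form A n ?z" unfolding k_def by (intro min) auto
    also have "quad_form A n ?z = quad_form A n y / s"
      using s unfolding quad_form_def sum_divide_distrib
      by (intro sum.cong) (auto simp: field_simps)
    finally show ?thesis using s unfolding R_def s_def[symmetric] by (simp add: field_simps)
  qed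
  have Rx: "R x = 0" using x by (simp add: R_def k_def)
  \<comment> \<open>The residual \<open>A x - k x\<close>, half the gradient of \<open>R\<close> at
    \<open>x\<close>. Moving against it would make \<open>R\<close> negative unless \<open>b\<close>
    vanishes.\<close>
  define b where "b i = (\<Sum>j<n. A $$ (i, j) * x j) - k * x i" for i
  have expand: "R (\<lambda>i. x i + t * b i) = 2 * t * (\<Sum>i<n. (b i)\<^sup>2) + t\<^sup>2 * R b" for t
  proof -
    have cross: "(\<Sum>i<n. \<Sum>j<n. A $$ (i, j) * x i * b j) = (\<Sum>i<n. \<Sum>j<n. A $$ (i, j) * b i * x j)"
      by (subst sum.swap) (auto intro!: sum.cong simp: sym)
    have "quad_form A n (\<lambda>i. x i + t * b i) = quad_form A n x + t * (\<Sum>i<n. \<Sum>j<n. A $$ (i, j) * x i * b j)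
        + t * (\<Sum>i<n. \<Sum>j<n. A $$ (i, j) * b i * x j) + t\<^sup>2 * quad_form A n b"
      unfolding quad_form_def
      by (simp add: algebra_simps power2_eq_square sum.distrib sum_distrib_left)
    then have q: "quad_form A n (\<lambda>i. x i + t * b i) = quad_form A n x
        + 2 * t * (\<Sum>i<n. b i * (\<Sum>j<n. A $$ (i, j) * x j)) + t\<^sup>2 * quad_form A n b"
      unfolding cross by (simp add: sum_distrib_left mult_ac)
    have "(\<Sum>i<n. (x i + t * b i)\<^sup>2) = (\<Sum>i<n. (x i)\<^sup>2) + 2 * t * (\<Sum>i<n. b i * x i) + t\<^sup>2 * (\<Sum>i<n. (b i)\<^sup>2)"
      by (simp add: power2_eq_square algebra_simps sum.distrib sum_distrib_left)
    then have "R (\<lambda>i. x i + t * b i) = R x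
        + 2 * t * ((\<Sum>i<n. b i * (\<Sum>j<n. A $$ (i, j) * x j)) - k * (\<Sum>i<n. b i * x i)) + t\<^sup>2 * R b"
      unfolding R_def q by (simp add: algebra_simps)
    also have "(\<Sum>i<n. b i * (\<Sum>j<n. A $$ (i, j) * x j)) - k * (\<Sum>i<n. b i * x i) = (\<Sum>i<n. (b i)\<^sup>2)"
      unfolding sum_distrib_left[of k] sum_subtractf[symmetric]
      by (intro sum.cong) (auto simp: b_def power2_eq_square algebra_simps)
    finally show ?thesis by (simp add: Rx)
  qed
  have "(\<Sum>i<n. (b i)\<^sup>2) = 0"
  proof (rule ccontr)
    define s where "s = (\<Sum>i<n. (b i)\<^sup>2)"
    assume "(\<Sum>i<n. (b i)\<^sup>2) \<noteq> 0"
    then have s: "0 < s" using sum_nonneg[of "{..<n}" "\<lambda>i. (b i)\<^sup>2"] unfolding s_def by simp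
    \<comment> \<open>Small enough that the first-order gain \<open>2 * s\<close> exceeds
      \<open>t * R b\<close>; the \<open>+ 1\<close> keeps the denominator positive when
      \<open>R b = 0\<close>.\<close>
    define t where "t = s / (R b + 1)"
    have t: "0 < t" using s bound[of b] by (simp add: t_def add_nonneg_pos)
    have "0 \<le> R (\<lambda>i. x i + (-t) * b i)" by (rule bound)
    also have "\<dots> = t * (t * R b - 2 * s)" unfolding expand by (simp add: s_def power2_eq_square algebra_simps)
    finally have "2 * s \<le> t * R b" using t by (simp add: zero_le_mult_iff)
    also have "t * R b \<le> t * (R b + 1)" using t by simp
    also have "\<dots> = s" using bound[of b] by (simp add: t_def)
    finally show False using s by simp
  qed
  then have "\<forall>i<n. b i = 0" by (subst (asm) sum_nonneg_eq_0_iff) auto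
  moreover have "\<exists>i<n. x i \<noteq> 0"
  proof (rule ccontr)
    assume "\<not> (\<exists>i<n. x i \<noteq> 0)"
    then have "(\<Sum>i<n. (x i)\<^sup>2) = 0" by simp
    then show False using x by simp
  qed
  ultimately have "eigenvalue A k"
    using eigenvalueI_fun[OF A, of x k] by (auto simp: b_def)
  moreover have "k * (\<Sum>i<n. (y i)\<^sup>2) \<le> quad_form A n y" for y
    using bound[of y] by (simp add: R_def)
  ultimately show thesis by (rule that)
qed

section \<open>Spectrum of the adjacency matrix and the range of the fugacity\<close>

lemma adjacency_matrix_carrier: "adjacency_matrix n E \<in> carrier_mat n n"
  by (simp add: adjacency_matrix_def)

lemma adjacency_matrix_index:
  "i < n \<Longrightarrow> j < n \<Longrightarrow> adjacency_matrix n E $$ (i, j) = (if {i, j} \<in> E then 1 else 0)"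
  by (simp add: adjacency_matrix_def)

text \<open>The eigenvalue \<open>k\<close> bounding the Rayleigh quotient shows that the finite
  spectrum is nonempty, so \<open>Min\<close> is attained; being at most \<open>k\<close>, it
  inherits the bound.\<close>

lemma adjacency_min_eigenvalue:
  assumes "0 < n"
  shows "eigenvalue (adjacency_matrix n E) (lambda_min (adjacency_matrix n E))"
    and "lambda_min (adjacency_matrix n E) * (\<Sum>i<n. (x i)\<^sup>2) \<le> quad_form (adjacency_matrix n E) n x"
proof -
  let ?A = "adjacency_matrix n E"
  have sym: "?A $$ (i, j) = ?A $$ (j, i)" if "i < n" "j < n" for i j
    using that by (simp add: adjacency_matrix_index insert_commute)
  obtain k where k: "eigenvalue ?A k" "\<And>x. k * (\<Sum>i<n. (x i)\<^sup>2) \<le> quad_form ?A n x"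
    using symmetric_min_eigenvalue[OF adjacency_matrix_carrier assms sym] by blast
  have fin: "finite (spectrum ?A)"
    using card_finite_spectrum adjacency_matrix_carrier by blast
  have "Min (spectrum ?A) \<in> spectrum ?A"
    using fin k(1) by (intro Min_in) (auto simp: spectrum_def)
  then show "eigenvalue ?A (lambda_min ?A)" by (simp add: lambda_min_def spectrum_def)
  have "lambda_min ?A \<le> k" using fin k(1) by (simp add: lambda_min_def spectrum_def)
  then have "lambda_min ?A * (\<Sum>i<n. (x i)\<^sup>2) \<le> k * (\<Sum>i<n. (x i)\<^sup>2)"
    by (intro mult_right_mono sum_nonneg) auto
  then show "lambda_min ?A * (\<Sum>i<n. (x i)\<^sup>2) \<le> quad_form ?A n x" using k(2)[of x] by simp
qed

text \<open>If adjacency is transitive on distinct vertices, \<open>A + I\<close> is the matrix of an equivalence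
  relation, whose nonzero eigenvalues are class sizes. Otherwise \<open>G\<close> has an induced path
  \<open>u v w\<close>, on which the vector \<open>(1, -\<surd>2, 1)\<close> has Rayleigh quotient \<open>-\<surd>2\<close>.\<close>

lemma lambda_min_gap:
  assumes n: "0 < n" and G: "simple_graph n E"
    and less: "lambda_min (adjacency_matrix n E) < -1"
  shows "lambda_min (adjacency_matrix n E) \<le> - sqrt 2"
proof -
  let ?A = "adjacency_matrix n E"
  define r where "r = lambda_min ?A"
  have loop: "{u, u} \<notin> E" for u
    using G by (auto simp: simple_graph_def)
  have "\<exists>u v w. {u, v} \<in> E \<and> {v, w} \<in> E \<and> {u, w} \<notin> E \<and> u \<noteq> w"
  proof (rule ccontr)
    assume "\<not> ?thesis"
    then have tr: "\<And>u v w. {u, v} \<in> E \<Longrightarrow> {v, w} \<in> E \<Longrightarrow> u \<noteq> w \<Longrightarrow> {u, w} \<in> E" by blast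
    define cls where "cls u = {v. v < n \<and> (v = u \<or> {u, v} \<in> E)}" for u
    have cls_sub: "cls v \<subseteq> cls u" if "v \<in> cls u" for u v
      using that tr[of u v] unfolding cls_def by blast
    have cls_eq: "cls v = cls u" if "v \<in> cls u" "u < n" for u v
    proof -
      have "u \<in> cls v" using that by (auto simp: cls_def insert_commute)
      then show ?thesis using cls_sub that by blast
    qed
    obtain x u where x: "\<And>i. i < n \<Longrightarrow> (\<Sum>j<n. ?A $$ (i, j) * x j) = r * x i" "u < n" "x u \<noteq> 0"
      using eigenvalueE_fun[OF adjacency_matrix_carrier adjacency_min_eigenvalue(1)[OF n], of E]
      unfolding r_def by metis
    \<comment> \<open>Row \<open>i\<close> of \<open>(A + I) x = (r + 1) x\<close>: the left side
      sums \<open>x\<close> over the class of \<open>i\<close>.\<close>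
    have sum_cls: "(\<Sum>j\<in>cls i. x j) = (r + 1) * x i" if i: "i < n" for i
    proof -
      have "(\<Sum>j\<in>cls i. x j) = (\<Sum>j<n. if j = i \<or> {i, j} \<in> E then x j else 0)"
        unfolding cls_def by (intro sum.mono_neutral_cong_left) auto
      also have "\<dots> = (\<Sum>j<n. (if j = i then x j else 0) + ?A $$ (i, j) * x j)"
        using i loop by (intro sum.cong) (auto simp: adjacency_matrix_index)
      also have "\<dots> = x i + r * x i"
        using i by (simp add: sum.distrib x(1))
      finally show ?thesis by (simp add: algebra_simps)
    qed
    \<comment> \<open>Class sums agree within a class and \<open>r + 1\<close> is nonzero, so the
      eigenvector is constant there; then \<open>r + 1\<close> is a class size, which cannot be
      negative.\<close>
    have const: "x j = x u" if "j \<in> cls u" for j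
    proof -
      have "j < n" using that by (simp add: cls_def)
      then have "(r + 1) * x j = (r + 1) * x u"
        using sum_cls[of j] sum_cls[of u] cls_eq[OF that x(2)] x(2) by metis
      then show ?thesis using less by (auto simp: r_def)
    qed
    have "(r + 1) * x u = (\<Sum>j\<in>cls u. x u)"
      using sum_cls[OF x(2)] const by (metis (no_types, lifting) sum.cong)
    also have "\<dots> = real (card (cls u)) * x u" by simp
    finally have "r + 1 = real (card (cls u))" using x(3) by simp
    then show False using less unfolding r_def by linarith
  qed
  then obtain u v w where uvw: "{u, v} \<in> E" "{v, w} \<in> E" "{u, w} \<notin> E" "u \<noteq> w" by blast
  have lt: "u < n" "v < n" "w < n"
    using G uvw by (auto simp: simple_graph_def)
  have neq: "u \<noteq> v" "v \<noteq> w" using uvw loop by auto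
  define x where "x i = (if i = u \<or> i = w then 1 else if i = v then - sqrt 2 else 0)" for i
  have sub: "{u, v, w} \<subseteq> {..<n}" using lt by auto
  have "(\<Sum>i<n. (x i)\<^sup>2) = (\<Sum>i\<in>{u, v, w}. (x i)\<^sup>2)"
    using sub by (intro sum.mono_neutral_right) (auto simp: x_def)
  also have "\<dots> = 4" using neq uvw(4) by (simp add: x_def)
  finally have s: "(\<Sum>i<n. (x i)\<^sup>2) = 4" .
  have "quad_form ?A n x = (\<Sum>i\<in>{u, v, w}. \<Sum>j<n. ?A $$ (i, j) * x i * x j)"
    unfolding quad_form_def using sub by (intro sum.mono_neutral_right) (auto simp: x_def)
  also have "\<dots> = (\<Sum>i\<in>{u, v, w}. \<Sum>j\<in>{u, v, w}. ?A $$ (i, j) * x i * x j)"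
    using sub by (intro sum.cong sum.mono_neutral_right) (auto simp: x_def)
  also have "\<dots> = - 4 * sqrt 2"
    using neq uvw lt loop by (simp add: x_def adjacency_matrix_index insert_commute)
  finally show ?thesis
    using adjacency_min_eigenvalue(2)[OF n, of E x] unfolding s by simp
qed

text \<open>A positive \<open>l\<close> below the quotient forces a positive denominator, so the
  quotient can be cleared and \<open>lambda_min_gap\<close> applies. The latter makes the
  denominator at least \<open>sqrt 2 - 1 \<ge> 2 / 5\<close>.\<close>

lemma fugacity_bounds:
  assumes "0 < n" "simple_graph n E" "0 < \<delta>" "\<delta> < 1" "0 < l"
    and l: "l \<le> (1 - \<delta>) / (- lambda_min (adjacency_matrix n E) - 1)"
  shows "\<delta> \<le> 1 + l + l * lambda_min (adjacency_matrix n E)" and "l \<le> 5 / 2"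
proof -
  define r where "r = lambda_min (adjacency_matrix n E)"
  have pos: "0 < - r - 1"
  proof (rule ccontr)
    assume "\<not> ?thesis"
    then have "(1 - \<delta>) / (- r - 1) \<le> 0" using assms by (intro divide_nonneg_nonpos) auto
    then show False using l \<open>0 < l\<close> by (simp add: r_def)
  qed
  then have le: "l * (- r - 1) \<le> 1 - \<delta>" using l by (simp add: r_def field_simps)
  then show "\<delta> \<le> 1 + l + l * lambda_min (adjacency_matrix n E)"
    by (simp add: r_def algebra_simps)
  have "r \<le> - sqrt 2" using lambda_min_gap assms pos by (simp add: r_def)
  moreover have "7 / 5 \<le> sqrt 2" by (rule real_le_rsqrt) (simp add: power2_eq_square)
  ultimately have "l * (2 / 5) \<le> l * (- r - 1)" using \<open>0 < l\<close> by (intro mult_left_mono) auto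
  then show "l \<le> 5 / 2" using le \<open>0 < \<delta>\<close> by simp
qed

section \<open>Sums of projections satisfying a Bochner inequality\<close>

text \<open>Idempotence and symmetry make the \<open>D v\<close> orthogonal projections in L^2(w).
  Linearity is asked at every point, also outside \<open>X\<close>, so that \<open>gen\<close> can
  be rewritten inside function arguments.\<close>

locale projection_family =
  fixes X :: "'a set" and w :: "'a \<Rightarrow> real" and I :: "'i set"
    and D :: "'i \<Rightarrow> ('a \<Rightarrow> real) \<Rightarrow> 'a \<Rightarrow> real"
  assumes fin_X: "finite X" and w_nonneg: "x \<in> X \<Longrightarrow> 0 \<le> w x" and w_sum: "sum w X = 1"
    and fin_I: "finite I" and I_ne: "I \<noteq> {}"
    and D_linear: "D v (\<lambda>x. a * f x + b * g x) x = a * D v f x + b * D v g x"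
    and D_const: "D v (\<lambda>_. 1) x = 0"
    and D_idem: "x \<in> X \<Longrightarrow> D v (D v f) x = D v f x"
    and D_sym: "v \<in> I \<Longrightarrow> (\<Sum>x\<in>X. w x * (D v f x * g x)) = (\<Sum>x\<in>X. w x * (f x * D v g x))"
begin

definition ip :: "('a \<Rightarrow> real) \<Rightarrow> ('a \<Rightarrow> real) \<Rightarrow> real" where
  "ip f g = (\<Sum>x\<in>X. w x * (f x * g x))"

definition gen :: "('a \<Rightarrow> real) \<Rightarrow> 'a \<Rightarrow> real" where
  "gen f x = (\<Sum>v\<in>I. D v f x)"

definition step :: "('a \<Rightarrow> real) \<Rightarrow> 'a \<Rightarrow> real" where
  "step f x = f x - gen f x / real (card I)"

definition energy :: "('a \<Rightarrow> real) \<Rightarrow> real" where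
  "energy f = ip (gen f) f"

definition mean :: "('a \<Rightarrow> real) \<Rightarrow> real" where
  "mean f = (\<Sum>x\<in>X. w x * f x)"

definition var :: "('a \<Rightarrow> real) \<Rightarrow> real" where
  "var f = ip f f - (mean f)\<^sup>2"

lemma card_I_pos: "0 < real (card I)"
  using fin_I I_ne by (simp add: card_gt_0_iff)

lemma ip_commute: "ip f g = ip g f"
  by (simp add: ip_def mult_ac)

lemma ip_nonneg: "0 \<le> ip f f"
  unfolding ip_def using w_nonneg by (intro sum_nonneg) simp

lemma ip_lincomb_left: "ip (\<lambda>x. a * f x + b * g x) h = a * ip f h + b * ip g h"
  by (simp add: ip_def algebra_simps sum.distrib sum_distrib_left)

lemma ip_lincomb_right: "ip h (\<lambda>x. a * f x + b * g x) = a * ip h f + b * ip h g"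
  by (simp add: ip_commute[of h] ip_lincomb_left)

lemma ip_gen_left: "ip (gen f) g = (\<Sum>v\<in>I. ip (D v f) g)"
  unfolding ip_def gen_def by (subst sum.swap) (simp add: sum_distrib_right sum_distrib_left)

lemma ip_gen_sym: "ip (gen f) g = ip f (gen g)"
proof -
  have "ip (D v f) g = ip (D v g) f" if "v \<in> I" for v
    using D_sym[OF that, of f g] by (simp add: ip_def mult_ac)
  then show ?thesis by (simp add: ip_commute[of f] ip_gen_left)
qed

lemma ip_D_D: "v \<in> I \<Longrightarrow> ip (D v f) (D v g) = ip (D v f) g"
  using D_sym[of v "D v f" g] D_idem by (simp add: ip_def)

lemma gen_linear: "gen (\<lambda>x. a * f x + b * g x) x = a * gen f x + b * gen g x"
  by (simp add: gen_def D_linear sum.distrib sum_distrib_left)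

lemma energy_eq: "energy f = (\<Sum>v\<in>I. ip (D v f) (D v f))"
  by (simp add: energy_def ip_gen_left ip_D_D)

lemma energy_nonneg: "0 \<le> energy f"
  unfolding energy_eq by (intro sum_nonneg ip_nonneg)

text \<open>Each projection is a contraction, since the squared norm of \<open>f - D v f\<close> is
  the difference of the squared norms of \<open>f\<close> and \<open>D v f\<close>.\<close>

lemma energy_le: "energy f \<le> real (card I) * ip f f"
proof -
  have "ip (D v f) (D v f) \<le> ip f f" if v: "v \<in> I" for v
  proof -
    have "0 \<le> ip (\<lambda>x. 1 * f x + (-1) * D v f x) (\<lambda>x. 1 * f x + (-1) * D v f x)"
      by (rule ip_nonneg)
    also have "\<dots> = ip f f - ip (D v f) (D v f)"
      unfolding ip_lincomb_left ip_lincomb_right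
      by (simp add: ip_D_D v ip_commute[of f "D v f"])
    finally show ?thesis by simp
  qed
  then show ?thesis unfolding energy_eq using sum_bounded_above[of I "\<lambda>v. ip (D v f) (D v f)"] by simp
qed

text \<open>Cauchy-Schwarz over \<open>I\<close> at every point.\<close>

lemma ip_gen_gen_le: "ip (gen f) (gen f) \<le> real (card I) * energy f"
proof -
  have "w x * (gen f x)\<^sup>2 \<le> w x * (real (card I) * (\<Sum>v\<in>I. (D v f x)\<^sup>2))" if "x \<in> X" for x
    using sum_squared_le_sum_of_squares[of "\<lambda>v. D v f x" I] w_nonneg[OF that]
    unfolding gen_def by (intro mult_left_mono) (simp_all add: mult.commute)
  then have "ip (gen f) (gen f) \<le> (\<Sum>x\<in>X. w x * (real (card I) * (\<Sum>v\<in>I. (D v f x)\<^sup>2)))"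
    unfolding ip_def by (intro sum_mono) (simp add: power2_eq_square)
  also have "\<dots> = real (card I) * energy f"
    unfolding energy_eq ip_def
    by (subst sum.swap) (simp add: sum_distrib_left power2_eq_square mult_ac)
  finally show ?thesis .
qed

section \<open>Mean, variance and energy along the chain\<close>

lemma step_eq: "step f = (\<lambda>x. 1 * f x + (- 1 / real (card I)) * gen f x)"
  by (simp add: step_def fun_eq_iff)

text \<open>Stationarity of \<open>w\<close>: symmetry moves \<open>gen\<close> onto the constant
  function, which it annihilates.\<close>

lemma mean_step: "mean (step f) = mean f"
proof -
  have 1: "mean g = ip (\<lambda>_. 1) g" for g by (simp add: mean_def ip_def)
  have "gen (\<lambda>_. 1) x = 0" for x by (simp add: gen_def D_const)
  then have "ip (\<lambda>_. 1) (gen f) = 0" by (simp flip: ip_gen_sym) (simp add: ip_def)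
  then show ?thesis unfolding 1 step_eq ip_lincomb_right by simp
qed

text \<open>Both bounds come from expanding the squared norm of \<open>f - gen f / n\<close>: the
  quadratic term is at most \<open>energy f / n\<close> and at least 0.\<close>

lemma var_step: "var (step f) \<le> var f - energy f / real (card I)"
  and var_le_step: "var f \<le> var (step f) + 2 / real (card I) * energy f"
proof -
  let ?n = "real (card I)"
  have "ip (step f) (step f) = ip f f - 2 / ?n * energy f + ip (gen f) (gen f) / ?n\<^sup>2"
    unfolding step_eq ip_lincomb_left ip_lincomb_right energy_def
    using card_I_pos by (simp add: ip_commute[of f "gen f"] field_simps power2_eq_square)
  then have *: "var (step f) = var f - 2 / ?n * energy f + ip (gen f) (gen f) / ?n\<^sup>2"
    by (simp add: var_def mean_step)
  have "ip (gen f) (gen f) / ?n\<^sup>2 \<le> ?n * energy f / ?n\<^sup>2"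
    by (intro divide_right_mono ip_gen_gen_le) auto
  also have "\<dots> = energy f / ?n" using card_I_pos by (simp add: power2_eq_square)
  finally show "var (step f) \<le> var f - energy f / ?n" using * by simp
  show "var f \<le> var (step f) + 2 / ?n * energy f"
    using * ip_nonneg[of "gen f"] by simp
qed

lemma sum_square_shift: "(\<Sum>x\<in>X. w x * (f x - b)\<^sup>2) = var f + (mean f - b)\<^sup>2"
proof -
  have "(\<Sum>x\<in>X. w x * (f x - b)\<^sup>2)
      = (\<Sum>x\<in>X. w x * (f x * f x)) - 2 * b * (\<Sum>x\<in>X. w x * f x) + b\<^sup>2 * sum w X"
    by (simp add: algebra_simps power2_eq_square sum.distrib sum_subtractf
        sum_distrib_left sum_distrib_right)
  then show ?thesis
    unfolding w_sum by (simp add: var_def ip_def mean_def power2_eq_square algebra_simps)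
qed

lemma var_le_shift: "var f \<le> (\<Sum>x\<in>X. w x * (f x - b)\<^sup>2)"
  by (simp add: sum_square_shift)

text \<open>Turns decay in L^2 into a bound at a single state, at the price of a factor
  \<open>1 / w x\<close>.\<close>

lemma point_var:
  assumes "x \<in> X"
  shows "w x * (f x - mean f)\<^sup>2 \<le> var f"
proof -
  have "w x * (f x - mean f)\<^sup>2 \<le> (\<Sum>x\<in>X. w x * (f x - mean f)\<^sup>2)"
    using assms fin_X w_nonneg by (intro member_le_sum) auto
  then show ?thesis by (simp add: sum_square_shift)
qed

text \<open>Passing from the Bochner inequality \<open>\<kappa> L \<le> L\<^sup>2\<close> to a Poincare inequality normally uses
  the spectral theorem. Here the energy decays geometrically along the chain, and summing the
  decrements of the variance gives the Poincare inequality up to a factor 2; the crude constant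
  \<open>c\<close> only serves to make the variance vanish in the limit.\<close>

lemma bochner_poincare:
  assumes bochner: "\<And>f. \<kappa> * energy f \<le> ip (gen f) (gen f)" and \<kappa>: "0 < \<kappa>" "\<kappa> \<le> real (card I)"
    and crude: "\<And>f. var f \<le> c * energy f" and c: "0 \<le> c"
  shows "\<kappa> / 2 * var f \<le> energy f"
proof -
  let ?n = "real (card I)"
  define q where "q = 1 - \<kappa> / ?n"
  have q: "0 \<le> q" "q < 1" using \<kappa> card_I_pos by (auto simp: q_def)
  \<comment> \<open>In the expansion, the last term is \<open>energy (gen f) / n^2\<close>;
    \<open>energy_le\<close> at \<open>gen f\<close> lets it cancel half of the middle term, and the
    Bochner inequality handles the rest.\<close>
  have decay: "energy (step f) \<le> q * energy f" for f
  proof -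
    have gs: "gen (step f) = (\<lambda>x. 1 * gen f x + (- 1 / ?n) * gen (gen f) x)"
      unfolding step_eq fun_eq_iff gen_linear by simp
    have "energy (step f) = energy f - 2 / ?n * ip (gen f) (gen f) + energy (gen f) / ?n\<^sup>2"
      unfolding energy_def[of "step f"] gs
      unfolding step_eq ip_lincomb_left ip_lincomb_right energy_def
      using card_I_pos by (simp add: ip_gen_sym[of "gen f" f] field_simps power2_eq_square)
    also have "energy (gen f) / ?n\<^sup>2 \<le> ?n * ip (gen f) (gen f) / ?n\<^sup>2"
      by (intro divide_right_mono energy_le) auto
    also have "\<dots> = ip (gen f) (gen f) / ?n" using card_I_pos by (simp add: power2_eq_square)
    finally have "energy (step f) \<le> energy f - ip (gen f) (gen f) / ?n" by simp
    also have "\<dots> \<le> energy f - \<kappa> * energy f / ?n"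
      using bochner[of f] by (intro diff_left_mono divide_right_mono) auto
    finally show ?thesis by (simp add: q_def algebra_simps)
  qed
  \<comment> \<open>Unrolling \<open>var_le_step\<close> gives a geometric series with ratio
    \<open>q\<close> and total at most \<open>2 / \<kappa>\<close>, as
    \<open>1 - q = \<kappa> / n\<close>; \<open>crude\<close> is applied only to the remainder after
    \<open>T\<close> steps.\<close>
  have "var f \<le> (c * q ^ T + 2 / \<kappa>) * energy f" for T f
  proof (induction T arbitrary: f)
    case 0
    have "0 \<le> 2 / \<kappa> * energy f" using \<kappa> energy_nonneg by simp
    then show ?case using crude[of f] by (simp add: algebra_simps)
  next
    case (Suc T)
    have "var f \<le> var (step f) + 2 / ?n * energy f" by (rule var_le_step)
    also have "var (step f) \<le> (c * q ^ T + 2 / \<kappa>) * energy (step f)" by (rule Suc)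
    also have "\<dots> \<le> (c * q ^ T + 2 / \<kappa>) * (q * energy f)"
      using c q \<kappa> decay by (intro mult_left_mono add_nonneg_nonneg) auto
    also have "\<dots> + 2 / ?n * energy f = (c * q ^ Suc T + (2 / \<kappa> * q + 2 / ?n)) * energy f"
      by (simp add: algebra_simps)
    also have "2 / \<kappa> * q + 2 / ?n = 2 / \<kappa>"
      using \<kappa> card_I_pos by (simp add: q_def field_simps)
    finally show ?case by simp
  qed
  moreover have "(\<lambda>T. (c * q ^ T + 2 / \<kappa>) * energy f) \<longlonglongrightarrow> (c * 0 + 2 / \<kappa>) * energy f"
    using q by (intro tendsto_intros LIMSEQ_power_zero) auto
  ultimately have "var f \<le> (c * 0 + 2 / \<kappa>) * energy f"
    by (intro LIMSEQ_le_const) auto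
  then show ?thesis using \<kappa> by (simp add: field_simps)
qed

text \<open>The Poincare inequality with constant \<open>\<kappa> / 2\<close> makes each step
  contract the variance by \<open>1 - \<kappa> / (2 * n)\<close>, while the mean is
  preserved.\<close>

lemma bochner_convergence:
  assumes bochner: "\<And>f. \<kappa> * energy f \<le> ip (gen f) (gen f)" and \<kappa>: "0 < \<kappa>" "\<kappa> \<le> real (card I)"
    and crude: "\<And>f. var f \<le> c * energy f" and c: "0 \<le> c"
    and x: "x \<in> X"
  shows "w x * ((step ^^ t) f x - mean f)\<^sup>2 \<le> exp (- (\<kappa> / (2 * real (card I)) * real t)) * var f"
proof -
  let ?n = "real (card I)"
  define p where "p = 1 - \<kappa> / (2 * ?n)"
  have p: "0 \<le> p" using \<kappa> card_I_pos by (simp add: p_def field_simps)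
  have contract: "var (step f) \<le> p * var f" for f
  proof -
    have "\<kappa> / 2 * var f / ?n \<le> energy f / ?n"
      using bochner_poincare[OF bochner \<kappa> crude c] by (intro divide_right_mono) auto
    then show ?thesis using var_step[of f] by (simp add: p_def algebra_simps)
  qed
  have var_pow: "var ((step ^^ t) f) \<le> p ^ t * var f"
  proof (induction t)
    case (Suc t)
    have "var ((step ^^ Suc t) f) \<le> p * var ((step ^^ t) f)" using contract by simp
    also have "\<dots> \<le> p * (p ^ t * var f)" using Suc p by (rule mult_left_mono)
    finally show ?case by simp
  qed simp
  have mean_pow: "mean ((step ^^ t) f) = mean f" by (induction t) (simp_all add: mean_step)
  have "0 \<le> w x * (f x - mean f)\<^sup>2" using w_nonneg[OF x] by simp
  then have "0 \<le> var f" using point_var[OF x, of f] by linarith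
  moreover have "p ^ t \<le> exp (- (\<kappa> / (2 * ?n) * real t))"
  proof -
    have "p \<le> exp (- (\<kappa> / (2 * ?n)))"
      using exp_ge_add_one_self[of "- (\<kappa> / (2 * ?n))"] by (simp add: p_def)
    then have "p ^ t \<le> exp (- (\<kappa> / (2 * ?n))) ^ t" using p by (rule power_mono)
    also have "\<dots> = exp (- (\<kappa> / (2 * ?n) * real t))" by (simp add: mult.commute flip: exp_of_nat_mult)
    finally show ?thesis .
  qed
  ultimately have "p ^ t * var f \<le> exp (- (\<kappa> / (2 * ?n) * real t)) * var f" by (intro mult_right_mono)
  then show ?thesis using point_var[OF x, of "(step ^^ t) f"] var_pow unfolding mean_pow by simp
qed

end

section \<open>Markov kernels\<close>

text \<open>The definition appends a last step; splitting off the first one instead is what an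
  induction over functions of the starting state requires.\<close>

lemma kernel_pow_Suc: "kernel_pow P (Suc t) x = bind_pmf (P x) (kernel_pow P t)"
proof (induction t)
  case 0
  show ?case by (simp add: kernel_pow_def bind_return_pmf bind_return_pmf')
next
  case (Suc t)
  have "kernel_pow P (Suc (Suc t)) x = bind_pmf (kernel_pow P (Suc t) x) P"
    by (simp add: kernel_pow_def)
  also have "\<dots> = bind_pmf (P x) (\<lambda>y. bind_pmf (kernel_pow P t y) P)"
    unfolding Suc by (simp add: bind_assoc_pmf)
  also have "(\<lambda>y. bind_pmf (kernel_pow P t y) P) = kernel_pow P (Suc t)"
    by (simp add: kernel_pow_def fun_eq_iff)
  finally show ?case .
qed

lemma set_kernel_pow:
  assumes "\<And>x. x \<in> X \<Longrightarrow> set_pmf (P x) \<subseteq> X" and "x \<in> X"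
  shows "set_pmf (kernel_pow P t x) \<subseteq> X"
proof (induction t)
  case 0
  show ?case using assms(2) by (simp add: kernel_pow_def)
next
  case (Suc t)
  have "kernel_pow P (Suc t) x = bind_pmf (kernel_pow P t x) P" by (simp add: kernel_pow_def)
  then show ?case using Suc assms(1) by (simp add: set_bind_pmf) blast
qed

text \<open>Duality between evolving laws and evolving functions. \<open>T\<close> has to agree with
  the kernel on the closed set \<open>X\<close> only.\<close>

lemma expectation_kernel_pow:
  fixes f :: "'a \<Rightarrow> real"
  assumes closed: "\<And>x. x \<in> X \<Longrightarrow> set_pmf (P x) \<subseteq> X" and X: "finite X"
    and T: "\<And>g x. x \<in> X \<Longrightarrow> measure_pmf.expectation (P x) g = T g x" and x: "x \<in> X"
  shows "measure_pmf.expectation (kernel_pow P t x) f = (T ^^ t) f x"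
  using x
proof (induction t arbitrary: x)
  case 0
  show ?case by (simp add: kernel_pow_def)
next
  case (Suc t)
  have fin: "finite (set_pmf (kernel_pow P t y))" if "y \<in> X" for y
    using set_kernel_pow[OF closed that] X by (rule finite_subset)
  have "measure_pmf.expectation (kernel_pow P (Suc t) x) f
      = (\<Sum>y\<in>X. pmf (P x) y * measure_pmf.expectation (kernel_pow P t y) f)"
    unfolding kernel_pow_Suc using closed[OF Suc.prems] X fin
    by (subst pmf_expectation_bind[of X]) auto
  also have "\<dots> = (\<Sum>y\<in>X. pmf (P x) y * (T ^^ t) f y)"
    using Suc.IH by (intro sum.cong) auto
  also have "\<dots> = measure_pmf.expectation (P x) ((T ^^ t) f)"
    using closed[OF Suc.prems] X by (subst integral_measure_pmf[of X]) auto
  also have "\<dots> = (T ^^ Suc t) f x" using T[OF Suc.prems] by simp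
  finally show ?case .
qed

lemma tv_dist_le:
  assumes "\<And>A. \<bar>measure_pmf.prob p A - measure_pmf.prob q A\<bar> \<le> b"
  shows "tv_dist p q \<le> b"
  unfolding tv_dist_def using assms by (intro cSUP_least) auto

lemma mixing_time_le:
  assumes "finite X" "X \<noteq> {}" "\<And>x. x \<in> X \<Longrightarrow> tv_dist (kernel_pow P t x) \<mu> \<le> 1 / 4"
  shows "mixing_time X P \<mu> \<le> t"
  unfolding mixing_time_def using assms by (subst Max_le_iff) (auto intro: Least_le)

section \<open>The hardcore model\<close>

locale hardcore_model =
  fixes n :: nat and E :: "nat set set" and l :: real
  assumes n_pos: "0 < n" and graph: "simple_graph n E" and l_pos: "0 < l"
begin

abbreviation \<Omega> :: "nat set set" where "\<Omega> \<equiv> indep_sets_of n E"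

text \<open>The hardcore probability without the cutoff outside \<open>\<Omega>\<close>, hence
  positive everywhere; sums range over \<open>\<Omega>\<close>.\<close>

definition weight :: "nat set \<Rightarrow> real" where
  "weight S = l ^ card S / hardcore_Z n E l"

text \<open>Conditional expectation given the configuration off \<open>v\<close>. If
  \<open>v\<close> is blocked in an independent \<open>S\<close>, then \<open>v\<close> is not in
  \<open>S\<close> and nothing is resampled.\<close>

definition heat_bath :: "nat \<Rightarrow> (nat set \<Rightarrow> real) \<Rightarrow> nat set \<Rightarrow> real" where
  "heat_bath v f S =
     (if insert v S \<in> \<Omega> then (f (S - {v}) + l * f (insert v S)) / (1 + l) else f S)"

definition defect :: "nat \<Rightarrow> (nat set \<Rightarrow> real) \<Rightarrow> nat set \<Rightarrow> real" where
  "defect v f S = f S - heat_bath v f S"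

definition gradient :: "(nat set \<Rightarrow> real) \<Rightarrow> nat set \<Rightarrow> nat \<Rightarrow> real" where
  "gradient f S v = (if v \<notin> S \<and> insert v S \<in> \<Omega> then f (insert v S) - f S else 0)"

section \<open>Independent sets, their weights and the projections\<close>

lemma indep_mono: "S \<in> \<Omega> \<Longrightarrow> T \<subseteq> S \<Longrightarrow> T \<in> \<Omega>"
  by (auto simp: indep_sets_of_def)

lemma indep_finite: "S \<in> \<Omega> \<Longrightarrow> finite S"
  by (auto simp: indep_sets_of_def intro: finite_subset)

lemma indep_insert2:
  "insert u S \<in> \<Omega> \<Longrightarrow> insert v S \<in> \<Omega> \<Longrightarrow> {u, v} \<notin> E \<Longrightarrow> insert u (insert v S) \<in> \<Omega>"
  by (auto simp: indep_sets_of_def insert_commute)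

lemma indep_insert_adjacent: "insert u S \<in> \<Omega> \<Longrightarrow> {u, v} \<in> E \<Longrightarrow> v \<notin> S"
  by (auto simp: indep_sets_of_def)

lemma no_loop: "{u, u} \<notin> E"
  using graph by (auto simp: simple_graph_def)

lemma weight_pos: "0 < weight S"
  unfolding weight_def using l_pos hardcore_Z_pos by simp

lemma weight_sum: "sum weight \<Omega> = 1"
  unfolding weight_def sum_divide_distrib[symmetric] hardcore_Z_def[symmetric]
  using hardcore_Z_pos[OF l_pos, of n E] by simp

lemma weight_insert: "S \<in> \<Omega> \<Longrightarrow> v \<notin> S \<Longrightarrow> weight (insert v S) = l * weight S"
  by (simp add: weight_def indep_finite)

text \<open>The states at which \<open>v\<close> is free fall into pairs \<open>S\<close>,
  \<open>insert v S\<close> of weight ratio \<open>l\<close>; on all others \<open>h\<close>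
  vanishes.\<close>

lemma sum_pairing:
  assumes "\<And>S. S \<in> \<Omega> \<Longrightarrow> insert v S \<notin> \<Omega> \<Longrightarrow> h S = 0"
  shows "(\<Sum>S\<in>\<Omega>. weight S * h S)
    = (\<Sum>S | v \<notin> S \<and> insert v S \<in> \<Omega>. weight S * (h S + l * h (insert v S)))"
proof -
  define B where "B = {S. v \<notin> S \<and> insert v S \<in> \<Omega>}"
  have sub: "B \<union> insert v ` B \<subseteq> \<Omega>"
    unfolding B_def using indep_mono by blast
  have fB: "finite B" using sub finite_indep_sets_of by (meson finite_subset le_supE)
  have "(\<Sum>S\<in>\<Omega>. weight S * h S) = (\<Sum>S\<in>B \<union> insert v ` B. weight S * h S)"
  proof (rule sum.mono_neutral_right[OF finite_indep_sets_of sub], intro ballI)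
    fix S assume S: "S \<in> \<Omega> - (B \<union> insert v ` B)"
    have "insert v S \<notin> \<Omega>"
    proof
      assume *: "insert v S \<in> \<Omega>"
      then have "v \<in> S" using S by (auto simp: B_def)
      then have "S = insert v (S - {v})" by auto
      moreover have "S - {v} \<in> B" using * by (simp add: B_def)
      ultimately have "S \<in> insert v ` B" by (rule image_eqI)
      then show False using S by simp
    qed
    then show "weight S * h S = 0" using assms S by simp
  qed
  also have "\<dots> = (\<Sum>S\<in>B. weight S * h S) + (\<Sum>S\<in>insert v ` B. weight S * h S)"
    using fB by (intro sum.union_disjoint) (auto simp: B_def)
  also have "(\<Sum>S\<in>insert v ` B. weight S * h S) = (\<Sum>S\<in>B. weight (insert v S) * h (insert v S))"
    by (subst sum.reindex) (auto simp: inj_on_def B_def dest: insert_ident)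
  also have "\<dots> = (\<Sum>S\<in>B. weight S * (l * h (insert v S)))"
    using sub by (intro sum.cong) (auto simp: B_def weight_insert)
  finally show ?thesis
    by (simp add: B_def sum.distrib algebra_simps)
qed

lemma defect_stuck: "insert v S \<notin> \<Omega> \<Longrightarrow> defect v f S = 0"
  by (simp add: defect_def heat_bath_def)

lemma defect_flip:
  "insert v S \<in> \<Omega> \<Longrightarrow> defect v f S = f S - 1 / (1 + l) * f (S - {v}) - l / (1 + l) * f (insert v S)"
  by (simp add: defect_def heat_bath_def add_divide_distrib)

lemma defect_out:
  "v \<notin> S \<Longrightarrow> insert v S \<in> \<Omega> \<Longrightarrow> defect v f S = - (l / (1 + l)) * gradient f S v"
  using l_pos by (simp add: defect_def heat_bath_def gradient_def field_simps)

lemma defect_in: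
  "v \<notin> S \<Longrightarrow> insert v S \<in> \<Omega> \<Longrightarrow> defect v f (insert v S) = 1 / (1 + l) * gradient f S v"
  using l_pos by (simp add: defect_def heat_bath_def gradient_def field_simps)

text \<open>On a pair the defects are \<open>- l / (1 + l)\<close> and \<open>1 / (1 + l)\<close>
  times the gradient, and the second state weighs \<open>l\<close> times the first, so only the
  increment of \<open>g\<close> survives.\<close>

lemma defect_form:
  "(\<Sum>S\<in>\<Omega>. weight S * (defect v f S * g S))
    = l / (1 + l) * (\<Sum>S\<in>\<Omega>. weight S * (gradient f S v * gradient g S v))"
proof -
  have "(\<Sum>S\<in>\<Omega>. weight S * (defect v f S * g S))
      = (\<Sum>S | v \<notin> S \<and> insert v S \<in> \<Omega>.
          weight S * (defect v f S * g S + l * (defect v f (insert v S) * g (insert v S))))"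
    by (rule sum_pairing) (simp add: defect_stuck)
  also have "\<dots> = (\<Sum>S | v \<notin> S \<and> insert v S \<in> \<Omega>.
          l / (1 + l) * (weight S * (gradient f S v * gradient g S v)))"
  proof (intro sum.cong refl)
    fix S assume "S \<in> {S. v \<notin> S \<and> insert v S \<in> \<Omega>}"
    then have S: "v \<notin> S" "insert v S \<in> \<Omega>" by auto
    then have g: "g (insert v S) = g S + gradient g S v" by (simp add: gradient_def)
    show "weight S * (defect v f S * g S + l * (defect v f (insert v S) * g (insert v S)))
        = l / (1 + l) * (weight S * (gradient f S v * gradient g S v))"
      unfolding defect_out[OF S] defect_in[OF S] g by (simp add: algebra_simps add_divide_distrib)
  qed
  also have "\<dots> = (\<Sum>S\<in>\<Omega>. l / (1 + l) * (weight S * (gradient f S v * gradient g S v)))"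
  proof (rule sum.mono_neutral_left[OF finite_indep_sets_of])
    show "{S. v \<notin> S \<and> insert v S \<in> \<Omega>} \<subseteq> \<Omega>" using indep_mono by blast
  qed (auto simp: gradient_def)
  finally show ?thesis by (simp add: sum_distrib_left)
qed

text \<open>Flipping one of two nonadjacent vertices does not affect whether the other is
  free.\<close>

lemma defect_commute:
  assumes ne: "u \<noteq> v" and nadj: "{u, v} \<notin> E"
  shows "defect u (defect v f) S = defect v (defect u f) S"
proof -
  \<comment> \<open>If \<open>u\<close> is blocked, it stays blocked at every set that
    \<open>defect v\<close> evaluates, so both orders give 0.\<close>
  have zero: "defect v (defect u f) S = 0"
    if *: "insert u S \<notin> \<Omega>" and "{u, v} \<notin> E" for u v f
  proof (cases "insert v S \<in> \<Omega>")
    case True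
    have 1: "insert u (S - {v}) \<notin> \<Omega>"
    proof
      assume "insert u (S - {v}) \<in> \<Omega>"
      then have "insert u (insert v (S - {v})) \<in> \<Omega>"
        using True that(2) by (intro indep_insert2) auto
      then have "insert u S \<in> \<Omega>" by (rule indep_mono) auto
      then show False using * by simp
    qed
    have 2: "insert u (insert v S) \<notin> \<Omega>"
      using * indep_mono[of "insert u (insert v S)" "insert u S"] by auto
    show ?thesis using 1 2 *
      unfolding defect_def[of v] heat_bath_def[of v] by (simp add: defect_stuck)
  qed (simp add: defect_stuck)
  show ?thesis
  proof (cases "insert u S \<in> \<Omega> \<and> insert v S \<in> \<Omega>")
    case False
    then show ?thesis
      using zero[of u v f] zero[of v u f] nadj by (auto simp: defect_stuck insert_commute)
  next
    case True
    then have uv: "insert u (insert v S) \<in> \<Omega>" "insert v (insert u S) \<in> \<Omega>"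
      using indep_insert2 nadj by (auto simp: insert_commute)
    have minus: "insert u (S - {v}) \<in> \<Omega>" "insert v (S - {u}) \<in> \<Omega>"
      using True indep_mono[of "insert u S" "insert u (S - {v})"]
        indep_mono[of "insert v S" "insert v (S - {u})"] by auto
    have sets: "insert u S - {v} = insert u (S - {v})" "insert v S - {u} = insert v (S - {u})"
      "S - {v} - {u} = S - {u} - {v}" "insert v (insert u S) = insert u (insert v S)"
      using ne by auto
    \<comment> \<open>With both vertices free, each order expands to the same combination of values
      of \<open>f\<close> with products of \<open>p\<close> and \<open>q\<close> as
      coefficients.\<close>
    define p q where "p = 1 / (1 + l)" and "q = l / (1 + l)"
    have flip: "defect v f S = f S - p * f (S - {v}) - q * f (insert v S)"
      if "insert v S \<in> \<Omega>" for v S f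
      unfolding p_def q_def using that by (rule defect_flip)
    show ?thesis
      using True uv minus by (simp add: flip sets algebra_simps)
  qed
qed

text \<open>Symmetry is that of \<open>defect_form\<close> in \<open>f\<close> and \<open>g\<close>;
  idempotence holds because \<open>heat_bath v f\<close> takes equal values at
  \<open>S - {v}\<close> and \<open>insert v S\<close>.\<close>

sublocale projection_family \<Omega> weight "{..<n}" defect
proof
  fix v and a b :: real and f g :: "nat set \<Rightarrow> real" and S
  show "defect v (\<lambda>x. a * f x + b * g x) S = a * defect v f S + b * defect v g S"
    by (cases "insert v S \<in> \<Omega>")
       (simp_all add: defect_flip defect_stuck algebra_simps add_divide_distrib)
  show "defect v (\<lambda>_. 1) S = 0"
    using l_pos by (simp add: defect_def heat_bath_def)
  show "defect v (defect v f) S = defect v f S"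
    using l_pos by (simp add: defect_def[of _ "defect v f"] heat_bath_def[of _ "defect v f"])
       (simp add: defect_def heat_bath_def field_simps)
  show "(\<Sum>x\<in>\<Omega>. weight x * (defect v f x * g x)) = (\<Sum>x\<in>\<Omega>. weight x * (f x * defect v g x))"
    using defect_form[of v f g] defect_form[of v g f] by (simp add: mult_ac)
qed (use weight_pos weight_sum finite_indep_sets_of n_pos in \<open>auto intro: less_imp_le\<close>)

section \<open>Bochner and crude Poincare inequalities for the hardcore model\<close>

lemma energy_gradient:
  "energy f = l / (1 + l) * (\<Sum>S\<in>\<Omega>. weight S * (\<Sum>v<n. (gradient f S v)\<^sup>2))"
proof -
  have "energy f = (\<Sum>v<n. l / (1 + l) * (\<Sum>S\<in>\<Omega>. weight S * (gradient f S v * gradient f S v)))"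
    unfolding energy_def ip_gen_left by (simp add: ip_def defect_form)
  also have "\<dots> = l / (1 + l) * (\<Sum>v<n. \<Sum>S\<in>\<Omega>. weight S * (gradient f S v * gradient f S v))"
    by (simp only: sum_distrib_left)
  also have "\<dots> = l / (1 + l) * (\<Sum>S\<in>\<Omega>. weight S * (\<Sum>v<n. (gradient f S v)\<^sup>2))"
    by (subst sum.swap) (simp only: power2_eq_square sum_distrib_left)
  finally show ?thesis .
qed

text \<open>For commuting orthogonal projections the inner product is the squared norm of
  \<open>defect v (defect u f)\<close>.\<close>

lemma ip_defect_nonadjacent:
  assumes "u \<noteq> v" "{u, v} \<notin> E" "u < n" "v < n"
  shows "0 \<le> ip (defect u f) (defect v f)"
proof -
  have "ip (defect u f) (defect v f) = ip (defect u (defect u f)) (defect v f)"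
    unfolding ip_def by (simp add: D_idem)
  also have "\<dots> = ip (defect u f) (defect u (defect v f))"
    using D_sym[of u "defect u f" "defect v f"] assms by (simp add: ip_def)
  also have "\<dots> = ip (defect v (defect u f)) (defect u f)"
    by (simp add: ip_def defect_commute[OF assms(1,2)] mult_ac)
  also have "\<dots> = ip (defect v (defect u f)) (defect v (defect u f))"
    using assms by (simp add: ip_D_D)
  finally show ?thesis using ip_nonneg by simp
qed

text \<open>If both vertices are free then neither is occupied, since an occupied one would block
  its neighbour; otherwise both sides vanish.\<close>

lemma defect_adjacent:
  assumes "{u, v} \<in> E"
  shows "defect u f S * defect v f S = (l / (1 + l))\<^sup>2 * (gradient f S u * gradient f S v)"
proof (cases "insert u S \<in> \<Omega> \<and> insert v S \<in> \<Omega>")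
  case True
  then have "u \<notin> S" "v \<notin> S"
    using assms indep_insert_adjacent[of u S v] indep_insert_adjacent[of v S u]
    by (auto simp: insert_commute)
  with True show ?thesis by (simp add: defect_out power2_eq_square)
next
  case False
  then show ?thesis by (auto simp: defect_stuck gradient_def)
qed

text \<open>Projections at nonadjacent vertices commute, so their product is nonnegative; the products
  over adjacent vertices assemble into the quadratic form of the adjacency matrix at the gradient.\<close>

lemma bochner:
  assumes "\<delta> \<le> 1 + l + l * lambda_min (adjacency_matrix n E)"
  shows "\<delta> / (1 + l) * energy f \<le> ip (gen f) (gen f)"
proof -
  let ?A = "adjacency_matrix n E" and ?r = "lambda_min (adjacency_matrix n E)"
  define a where "a = l / (1 + l)"
  define N where "N S = (\<Sum>v<n. (gradient f S v)\<^sup>2)" for S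
  \<comment> \<open>Pointwise lower bound for the pair \<open>u\<close>, \<open>v\<close>, exact for
    equal or adjacent vertices and 0 for the others. The absence of loops keeps the adjacency term
    off the diagonal.\<close>
  define M where "M u v S = (if u = v then a * (gradient f S u)\<^sup>2 else 0)
    + a\<^sup>2 * (?A $$ (u, v) * gradient f S u * gradient f S v)" for u v S
  have le_ip: "(\<Sum>S\<in>\<Omega>. weight S * M u v S) \<le> ip (defect u f) (defect v f)"
    if uv: "u < n" "v < n" for u v
  proof -
    consider "u = v" | "u \<noteq> v" "{u, v} \<in> E" | "u \<noteq> v" "{u, v} \<notin> E" by blast
    then show ?thesis
    proof cases
      case 1
      then have "ip (defect u f) (defect v f) = a * (\<Sum>S\<in>\<Omega>. weight S * (gradient f S v)\<^sup>2)"
        using uv defect_form[of v f f] by (simp add: ip_D_D) (simp add: ip_def a_def power2_eq_square)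
      then show ?thesis using 1 uv no_loop[of v]
        by (simp add: M_def adjacency_matrix_index sum_distrib_left mult_ac)
    next
      case 2
      then show ?thesis using uv
        by (simp add: ip_def defect_adjacent M_def adjacency_matrix_index a_def mult_ac)
    next
      case 3
      then show ?thesis using uv ip_defect_nonadjacent[OF 3 uv]
        by (simp add: M_def adjacency_matrix_index)
    qed
  qed
  have sum_M: "(\<Sum>u<n. \<Sum>v<n. M u v S) = a * N S + a\<^sup>2 * quad_form ?A n (gradient f S)" for S
    unfolding M_def N_def quad_form_def by (simp add: sum.distrib sum_distrib_left)
  have "\<delta> / (1 + l) \<le> (1 + l + l * ?r) / (1 + l)"
    using assms l_pos by (intro divide_right_mono) auto
  also have "\<dots> = 1 + a * ?r" using l_pos by (simp add: a_def add_divide_distrib)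
  finally have "\<delta> / (1 + l) \<le> 1 + a * ?r" .
  then have "\<delta> / (1 + l) * energy f \<le> (1 + a * ?r) * energy f"
    using energy_nonneg by (rule mult_right_mono)
  also have "\<dots> = (\<Sum>S\<in>\<Omega>. weight S * (a * N S + a\<^sup>2 * (?r * N S)))"
    unfolding energy_gradient a_def[symmetric] N_def[symmetric]
    by (simp add: sum_distrib_left sum.distrib algebra_simps power2_eq_square)
  \<comment> \<open>Rayleigh bound for the adjacency matrix, applied to the gradient vector at each
    \<open>S\<close>.\<close>
  also have "\<dots> \<le> (\<Sum>S\<in>\<Omega>. weight S * (\<Sum>u<n. \<Sum>v<n. M u v S))"
    unfolding sum_M N_def
    using adjacency_min_eigenvalue(2)[OF n_pos, of E] weight_pos
    by (intro sum_mono mult_left_mono add_left_mono) (auto intro: less_imp_le)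
  also have "\<dots> = (\<Sum>u<n. \<Sum>v<n. \<Sum>S\<in>\<Omega>. weight S * M u v S)"
    unfolding sum_distrib_left
    by (subst sum.swap, rule sum.cong[OF refl], rule sum.swap)
  also have "\<dots> \<le> (\<Sum>u<n. \<Sum>v<n. ip (defect u f) (defect v f))"
    using le_ip by (intro sum_mono) auto
  also have "\<dots> = ip (gen f) (gen f)"
  proof -
    have "ip (defect u f) (gen f) = (\<Sum>v<n. ip (defect u f) (defect v f))" for u
      unfolding ip_commute[of "defect u f"] by (rule ip_gen_left)
    then show ?thesis by (simp only: ip_gen_left[of f "gen f"])
  qed
  finally show ?thesis .
qed

text \<open>Every state is joined to the empty set by adding vertices one at a time, and each
  increment is a gradient controlled by the energy. The size of \<open>c\<close> does not enter the
  final rate.\<close>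

lemma crude_poincare:
  obtains c where "0 \<le> c" "\<And>f. var f \<le> c * energy f"
proof -
  define a where "a = l / (1 + l)"
  have a: "0 < a" using l_pos by (simp add: a_def)
  \<comment> \<open>The sum over all states serves as an upper bound for the largest of the
    reciprocals.\<close>
  define K where "K = (\<Sum>T\<in>\<Omega>. 1 / (a * weight T))"
  have K_ge: "1 / (a * weight T) \<le> K" if "T \<in> \<Omega>" for T
    unfolding K_def using that finite_indep_sets_of a weight_pos
    by (intro member_le_sum) (auto simp: less_imp_le)
  have K: "0 \<le> K" unfolding K_def using a weight_pos by (intro sum_nonneg) (auto simp: less_imp_le)
  have grad: "\<bar>gradient f T v\<bar> \<le> sqrt (K * energy f)" if T: "T \<in> \<Omega>" and v: "v < n" for f T v
  proof -
    have "a * (weight T * (gradient f T v)\<^sup>2) \<le> a * (weight T * (\<Sum>v<n. (gradient f T v)\<^sup>2))"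
      using a v weight_pos[of T] by (intro mult_left_mono member_le_sum) auto
    also have "\<dots> \<le> energy f"
      unfolding energy_gradient a_def[symmetric]
      using a T finite_indep_sets_of weight_pos
      by (intro mult_left_mono member_le_sum[of T \<Omega> "\<lambda>S. weight S * (\<Sum>v<n. (gradient f S v)\<^sup>2)"])
         (auto intro!: mult_nonneg_nonneg sum_nonneg simp: less_imp_le)
    finally have "(gradient f T v)\<^sup>2 \<le> 1 / (a * weight T) * energy f"
      using a weight_pos[of T] by (simp add: field_simps)
    also have "\<dots> \<le> K * energy f" using K_ge[OF T] energy_nonneg by (rule mult_right_mono)
    finally have "sqrt ((gradient f T v)\<^sup>2) \<le> sqrt (K * energy f)" by (rule real_sqrt_le_mono)
    then show ?thesis by simp
  qed
  have path: "\<bar>f S - f {}\<bar> \<le> real (card S) * sqrt (K * energy f)" if "finite S" "S \<in> \<Omega>" for f S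
    using that
  proof (induction S)
    case (insert v S)
    have S: "S \<in> \<Omega>" using insert.prems indep_mono by blast
    have "v < n" using insert.prems by (auto simp: indep_sets_of_def)
    then have "\<bar>f (insert v S) - f S\<bar> \<le> sqrt (K * energy f)"
      using grad[OF S, of v f] insert by (simp add: gradient_def)
    then show ?case using insert.IH[OF S] insert.hyps by (simp add: algebra_simps)
  qed simp
  have "var f \<le> ((real n)\<^sup>2 * K) * energy f" for f
  proof -
    have "(f S - f {})\<^sup>2 \<le> (real n)\<^sup>2 * K * energy f" if S: "S \<in> \<Omega>" for S
    proof -
      have "card S \<le> n" using S card_mono[of "{..<n}" S] by (simp add: indep_sets_of_def)
      then have "real (card S) * sqrt (K * energy f) \<le> real n * sqrt (K * energy f)"
        using K energy_nonneg by (intro mult_right_mono) auto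
      then have "\<bar>f S - f {}\<bar> \<le> real n * sqrt (K * energy f)"
        using path[OF indep_finite[OF S] S, of f] by simp
      then have "\<bar>f S - f {}\<bar>\<^sup>2 \<le> (real n * sqrt (K * energy f))\<^sup>2" by (rule power_mono) simp
      also have "\<dots> = (real n)\<^sup>2 * K * energy f"
        using K energy_nonneg[of f] by (simp add: power_mult_distrib)
      finally show ?thesis by simp
    qed
    then have "(\<Sum>S\<in>\<Omega>. weight S * (f S - f {})\<^sup>2) \<le> (\<Sum>S\<in>\<Omega>. weight S * ((real n)\<^sup>2 * K * energy f))"
      using weight_pos by (intro sum_mono mult_left_mono) (auto intro: less_imp_le)
    also have "\<dots> = (real n)\<^sup>2 * K * energy f"
      unfolding sum_distrib_right[symmetric] weight_sum by simp
    finally show ?thesis using var_le_shift[of f "f {}"] by linarith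
  qed
  moreover have "0 \<le> (real n)\<^sup>2 * K" using K by simp
  ultimately show thesis using that by blast
qed

section \<open>The Glauber kernel and its convergence\<close>

lemma set_glauber: "S \<in> \<Omega> \<Longrightarrow> set_pmf (glauber n E l S) \<subseteq> \<Omega>"
  using n_pos indep_mono[of S]
  by (auto simp: glauber_def Let_def set_pmf_of_set lessThan_empty_iff split: if_splits)

text \<open>Identifies the random update with the averaging operator
  \<open>I - L / n\<close>.\<close>

lemma expectation_glauber:
  assumes S: "S \<in> \<Omega>"
  shows "measure_pmf.expectation (glauber n E l S) f = step f S"
proof -
  let ?m = "\<lambda>v. if insert v (S - {v}) \<notin> \<Omega> then return_pmf (S - {v})
       else map_pmf (\<lambda>b. if b then insert v (S - {v}) else S - {v}) (bernoulli_pmf (l / (1 + l)))"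
  have e: "measure_pmf.expectation (?m v) f = heat_bath v f S" for v
  proof (cases "insert v S \<in> \<Omega>")
    case True
    have "l / (1 + l) \<le> 1" "0 \<le> l / (1 + l)" "1 - l / (1 + l) = 1 / (1 + l)"
      using l_pos by (auto simp: field_simps)
    then show ?thesis using True by (simp add: heat_bath_def add_divide_distrib mult.commute)
  next
    case False
    \<comment> \<open>An occupied \<open>v\<close> would give \<open>insert v S = S\<close>, which
      is independent.\<close>
    then have "S - {v} = S" using S by (auto simp: insert_absorb)
    then show ?thesis using False by (simp add: heat_bath_def)
  qed
  have ne: "{..<n} \<noteq> {}" using n_pos by auto
  have "measure_pmf.expectation (glauber n E l S) f
      = (\<Sum>v<n. measure_pmf.expectation (?m v) f /\<^sub>R real n)"
    unfolding glauber_def Let_def using ne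
    by (subst pmf_expectation_bind_pmf_of_set) auto
  also have "\<dots> = (\<Sum>v<n. heat_bath v f S) / real n"
    unfolding e by (simp add: divide_inverse mult.commute sum_distrib_left)
  also have "\<dots> = step f S"
    using n_pos by (simp add: step_def gen_def defect_def sum_subtractf diff_divide_distrib)
  finally show ?thesis .
qed

lemma prob_hardcore: "measure_pmf.prob (hardcore n E l) A = mean (indicator A)"
proof -
  have "measure_pmf.prob (hardcore n E l) A = measure_pmf.expectation (hardcore n E l) (indicator A)"
    by simp
  also have "\<dots> = (\<Sum>S\<in>\<Omega>. pmf (hardcore n E l) S * indicator A S)"
    by (subst integral_measure_pmf[of \<Omega>])
       (use finite_indep_sets_of in \<open>auto simp: set_pmf_iff pmf_hardcore[OF l_pos] split: if_splits\<close>)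
  also have "\<dots> = mean (indicator A)"
    unfolding mean_def weight_def by (simp add: pmf_hardcore[OF l_pos])
  finally show ?thesis .
qed

text \<open>The convergence bound is applied to the indicator of an event, whose variance is at most
  1. The 16 is the square of the 4 in the threshold.\<close>

lemma tv_dist_kernel_pow:
  assumes \<delta>: "0 < \<delta>" "\<delta> < 1" "\<delta> \<le> 1 + l + l * lambda_min (adjacency_matrix n E)"
    and S: "S \<in> \<Omega>"
    and t: "16 * exp (- (\<delta> / (1 + l) / (2 * real n) * real t)) \<le> weight S"
  shows "tv_dist (kernel_pow (glauber n E l) t S) (hardcore n E l) \<le> 1 / 4"
proof (rule tv_dist_le)
  fix A :: "nat set set"
  let ?f = "indicator A :: nat set \<Rightarrow> real"
  define d where "d = (step ^^ t) ?f S - mean ?f"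
  have "measure_pmf.prob (kernel_pow (glauber n E l) t S) A
      = measure_pmf.expectation (kernel_pow (glauber n E l) t S) ?f" by simp
  also have "\<dots> = (step ^^ t) ?f S"
    by (rule expectation_kernel_pow[OF set_glauber finite_indep_sets_of expectation_glauber S])
  finally have d: "measure_pmf.prob (kernel_pow (glauber n E l) t S) A
      - measure_pmf.prob (hardcore n E l) A = d"
    by (simp add: d_def prob_hardcore)
  have "\<delta> / (1 + l) \<le> 1" using \<delta> l_pos by simp
  moreover have "1 \<le> real n" using n_pos by simp
  ultimately have \<kappa>: "0 < \<delta> / (1 + l)" "\<delta> / (1 + l) \<le> real (card {..<n})"
    using \<delta>(1) l_pos by (simp, simp only: card_lessThan)
  obtain c where c: "0 \<le> c" "\<And>f. var f \<le> c * energy f" using crude_poincare by blast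
  have "var ?f \<le> (\<Sum>x\<in>\<Omega>. weight x * (?f x - 0)\<^sup>2)" by (rule var_le_shift)
  also have "\<dots> \<le> (\<Sum>x\<in>\<Omega>. weight x)"
    using weight_pos by (intro sum_mono) (auto simp: indicator_def less_imp_le)
  finally have var1: "var ?f \<le> 1" by (simp add: weight_sum)
  have "weight S * d\<^sup>2 \<le> exp (- (\<delta> / (1 + l) / (2 * real (card {..<n})) * real t)) * var ?f"
    unfolding d_def by (rule bochner_convergence[OF bochner[OF \<delta>(3)] \<kappa> c(2,1) S])
  also have "\<dots> \<le> exp (- (\<delta> / (1 + l) / (2 * real n) * real t)) * 1"
    using var1 by (simp only: card_lessThan) (intro mult_left_mono, simp_all)
  also have "\<dots> \<le> weight S * (1 / 16)" using t by simp
  finally have "d\<^sup>2 \<le> (1 / 4)\<^sup>2" using weight_pos[of S] by (simp add: power2_eq_square)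
  then have "\<bar>d\<bar> \<le> 1 / 4" using abs_le_square_iff[of d "1 / 4"] by simp
  then show "\<bar>measure_pmf.prob (kernel_pow (glauber n E l) t S) A
      - measure_pmf.prob (hardcore n E l) A\<bar> \<le> 1 / 4" unfolding d .
qed

text \<open>The numerator is at least \<open>exp (- M * n)\<close>, and the partition function is at
  most \<open>2 ^ n * exp (3 / 2) ^ n \<le> exp (5 / 2 * n)\<close>; \<open>1 \<le> M\<close> merges
  the exponents into \<open>7 / 2 * n * M\<close>.\<close>

lemma weight_ge:
  assumes l: "l \<le> 5 / 2" and S: "S \<in> \<Omega>"
  shows "exp (- (7 / 2 * real n * max 1 (ln (1 / l)))) \<le> weight S"
proof -
  define M where "M = max 1 (ln (1 / l))"
  have M: "1 \<le> M" by (simp add: M_def)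
  have card_le: "card T \<le> n" if "T \<subseteq> {..<n}" for T
    using card_mono[OF _ that] by simp
  have "exp (- M) \<le> exp (- ln (1 / l))" by (simp add: M_def)
  also have "\<dots> = l" using l_pos by (simp add: ln_div)
  finally have lM: "exp (- M) \<le> l" .
  have "exp (- M * real n) \<le> exp (- M * real (card S))"
    using M card_le[of S] S by (simp add: indep_sets_of_def)
  also have "\<dots> = exp (- M) ^ card S" by (simp add: mult.commute flip: exp_of_nat_mult)
  also have "\<dots> \<le> l ^ card S" using lM by (intro power_mono) auto
  finally have num: "exp (- M * real n) \<le> l ^ card S" .
  have l_le: "l \<le> exp (3 / 2)" using l exp_ge_add_one_self[of "3 / 2"] by simp
  have "hardcore_Z n E l \<le> (\<Sum>T\<in>\<Omega>. exp (3 / 2) ^ n)"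
    unfolding hardcore_Z_def
  proof (rule sum_mono)
    fix T assume "T \<in> \<Omega>"
    then have "card T \<le> n" using card_le by (simp add: indep_sets_of_def)
    have "l ^ card T \<le> exp (3 / 2) ^ card T" using l_le l_pos by (intro power_mono) auto
    also have "\<dots> \<le> exp (3 / 2) ^ n" using \<open>card T \<le> n\<close> by (intro power_increasing) auto
    finally show "l ^ card T \<le> exp (3 / 2) ^ n" .
  qed
  also have "\<dots> \<le> (\<Sum>T\<in>Pow {..<n}. exp (3 / 2) ^ n)"
    by (intro sum_mono2) (auto simp: indep_sets_of_def)
  also have "\<dots> = 2 ^ n * exp (3 / 2) ^ n" by (simp add: card_Pow)
  also have "\<dots> \<le> exp 1 ^ n * exp (3 / 2) ^ n"
    using exp_ge_add_one_self[of 1] by (intro mult_right_mono power_mono) auto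
  also have "\<dots> = exp (5 / 2 * real n)" by (simp add: algebra_simps flip: exp_of_nat_mult exp_add)
  finally have "exp (- M * real n) / exp (5 / 2 * real n) \<le> weight S"
    unfolding weight_def using num hardcore_Z_pos[OF l_pos, of n E] l_pos by (intro frac_le) auto
  moreover have "exp (- (7 / 2 * real n * M)) \<le> exp (- M * real n) / exp (5 / 2 * real n)"
  proof -
    have "real n * 1 \<le> real n * M" using M by (intro mult_left_mono) auto
    then show ?thesis by (simp add: algebra_simps flip: exp_diff)
  qed
  ultimately show ?thesis by (simp add: M_def)
qed

lemma glauber_mixing_time:
  assumes \<delta>: "0 < \<delta>" "\<delta> < 1" "\<delta> \<le> 1 + l + l * lambda_min (adjacency_matrix n E)"
    and l: "l \<le> 5 / 2"
  shows "real (mixing_time \<Omega> (glauber n E l) (hardcore n E l))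
    \<le> 54 * ((real n)\<^sup>2 / \<delta> * max 1 (ln (1 / l)))"
proof -
  define M where "M = max 1 (ln (1 / l))"
  define B where "B = (real n)\<^sup>2 / \<delta> * M"
  \<comment> \<open>The rate is at least \<open>\<delta> / (7 * n)\<close> as
    \<open>1 + l \<le> 7 / 2\<close>, and \<open>53 / 7 \<ge> 15 / 2 = 4 + 7 / 2\<close>: the 4 pays
    for \<open>16 \<le> exp 4\<close>, the \<open>7 / 2\<close> for the smallest weight. Rounding up
    costs at most one more \<open>B\<close>.\<close>
  define t where "t = nat \<lceil>53 * B\<rceil>"
  have M: "1 \<le> M" by (simp add: M_def)
  have n: "1 \<le> real n" using n_pos by simp
  have "1 \<le> (real n)\<^sup>2" using n by simp
  then have "1 \<le> (real n)\<^sup>2 / \<delta>" using \<delta> by simp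
  then have "1 * 1 \<le> B" unfolding B_def using M by (intro mult_mono) auto
  then have B: "1 \<le> B" by simp
  then have "real t = of_int \<lceil>53 * B\<rceil>" by (simp add: t_def)
  then have t: "53 * B \<le> real t" "real t \<le> 54 * B" using B by linarith+
  have "tv_dist (kernel_pow (glauber n E l) t S) (hardcore n E l) \<le> 1 / 4" if S: "S \<in> \<Omega>" for S
  proof (rule tv_dist_kernel_pow[OF \<delta> S])
    have nM: "1 \<le> real n * M" using mult_mono[of 1 "real n" 1 M] n M by simp
    have "15 / 2 * (real n * M) \<le> \<delta> / (7 / 2) / (2 * real n) * (53 * B)"
      unfolding B_def using \<delta> n nM by (simp add: field_simps power2_eq_square)
    also have "\<dots> \<le> \<delta> / (1 + l) / (2 * real n) * real t"
      using \<delta> l l_pos B n t(1) by (intro mult_mono divide_right_mono divide_left_mono) auto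
    finally have rate: "15 / 2 * (real n * M) \<le> \<delta> / (1 + l) / (2 * real n) * real t" .
    have "(2::real) ^ 4 \<le> exp 1 ^ 4" using exp_ge_add_one_self[of 1] by (intro power_mono) auto
    then have "16 \<le> exp (4::real)" by (simp flip: exp_of_nat_mult)
    then have "16 * exp (- (\<delta> / (1 + l) / (2 * real n) * real t))
        \<le> exp 4 * exp (- (15 / 2 * (real n * M)))"
      using rate by (intro mult_mono) auto
    also have "\<dots> \<le> exp (- (7 / 2 * real n * M))"
      using nM by (simp add: algebra_simps flip: exp_add)
    also have "\<dots> \<le> weight S" unfolding M_def by (rule weight_ge[OF l S])
    finally show "16 * exp (- (\<delta> / (1 + l) / (2 * real n) * real t)) \<le> weight S" .
  qed
  then have "mixing_time \<Omega> (glauber n E l) (hardcore n E l) \<le> t"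
    using finite_indep_sets_of empty_in_indep_sets_of[of n E] by (intro mixing_time_le) auto
  then show ?thesis using t(2) unfolding B_def M_def by linarith
qed

end

text \<open>The constant is uniform in the graph and both parameters. The maximum with 1 covers
  \<open>l\<close> near or above 1, where \<open>ln (1 / l)\<close> is close to 0 or
  negative.\<close>

theorem theorem1p2:
  "\<exists>C::real. C > 0 \<and>
    (\<forall>(n::nat) (E::nat set set) (\<delta>::real) (l::real).
      0 < n \<longrightarrow> simple_graph n E \<longrightarrow> 0 < \<delta> \<longrightarrow> \<delta> < 1 \<longrightarrow> 0 < l \<longrightarrow>
      l \<le> (1 - \<delta>) / (- lambda_min (adjacency_matrix n E) - 1) \<longrightarrow>
      real (mixing_time (indep_sets_of n E) (glauber n E l) (hardcore n E l))
        \<le> C * ((real n)\<^sup>2 / \<delta> * max 1 (ln (1 / l))))"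
proof (intro exI[of _ 54] conjI allI impI)
  fix n E and \<delta> l :: real
  assume *: "0 < n" "simple_graph n E" "0 < \<delta>" "\<delta> < 1" "0 < l"
    "l \<le> (1 - \<delta>) / (- lambda_min (adjacency_matrix n E) - 1)"
  then interpret hardcore_model n E l by unfold_locales
  show "real (mixing_time (indep_sets_of n E) (glauber n E l) (hardcore n E l))
        \<le> 54 * ((real n)\<^sup>2 / \<delta> * max 1 (ln (1 / l)))"
    by (rule glauber_mixing_time[OF *(3,4) fugacity_bounds[OF *]])
qed simp

end
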